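(* Let $G$ be a connected bipartite graph on vertex set $\{1,\dots,n\}$, and let $\mathbf{x}=(x_1,\dots,x_n)$ and $\mathbf{y}=(y_1,\dots,y_n)$ be unit eigenvectors of the adjacency matrix of $G$ corresponding to its largest eigenvalue $\mu_1(G)$ and its smallest eigenvalue $\mu_n(G)$, respectively. Then \[ \lim_{k\to\infty}\frac{1}{w_{2k+1}(G)}\bigl(w_{2k+1}(1),\dots,w_{2k+1}(n)\bigr)\ \ge\ \frac{|x_1+\dots+x_n|-|y_1+\dots+y_n|}{|x_1+\dots+x_n|^2+|y_1+\dots+y_n|^2}\,\mathbf{x} \] and \[ \lim_{k\to\infty}\frac{1}{w_{2k}(G)}\bigl(w_{2k}(1),\dots,w_{2k}(n)\bigr)\ \ge\ \frac{1}{|x_1+\dots+x_n|+|y_1+\dots+y_n|}\,\mathbf{x}. \]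
   Context: A $k$-walk in a graph $G$ is a sequence of vertices $v_1,\dots,v_k$ with $v_i$ adjacent to $v_{i+1}$ for $i=1,\dots,k-1$. $w_k(G)$ denotes the number of $k$-walks in $G$ and $w_k(u)$ the number of $k$-walks starting at vertex $u$. For vectors, $\mathbf{a}\le\mathbf{b}$ means $a_i\le b_i$ for every coordinate $i$. The eigenvalues of the adjacency matrix are ordered $\mu_1(G)\ge\dots\ge\mu_n(G)$. *)

theory Defs
  imports "HOL-Analysis.Analysis" "Graph_Theory.Vertex_Walk" "Graph_Theory.Digraph_Component"
begin

text \<open>
  Simple graphs are the finite, loopless, symmetric digraphs without multiple arcs of
  \<^theory>\<open>Graph_Theory.Digraph\<close>. The names \<open>graph\<close> and \<open>connected\<close> are also
  used in \<open>Map\<close> and in topology, hence the qualified names.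
\<close>

definition bipartite :: "('a, 'b) pre_digraph \<Rightarrow> bool" where
  "bipartite G \<longleftrightarrow> (\<exists>U V. verts G = U \<union> V \<and> U \<inter> V = {} \<and>
     arcs_ends G \<subseteq> U \<times> V \<union> V \<times> U)"

text \<open>A \<open>k\<close>-walk has \<open>k\<close> vertices. As \<^const>\<open>vwalk\<close> excludes the empty list, the
  counts below are \<open>0\<close> for \<open>k = 0\<close>.\<close>

definition num_walks :: "('a, 'b) pre_digraph \<Rightarrow> nat \<Rightarrow> nat" where
  "num_walks G k = card {p. vwalk p G \<and> length p = k}"

definition num_walks_from :: "('a, 'b) pre_digraph \<Rightarrow> nat \<Rightarrow> 'a \<Rightarrow> nat" where
  "num_walks_from G k u = card {p. vwalk p G \<and> length p = k \<and> hd p = u}"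

definition walk_vector :: "('n::finite, 'b) pre_digraph \<Rightarrow> nat \<Rightarrow> real ^ 'n" where
  "walk_vector G k = (\<chi> u. real (num_walks_from G k u))"

definition adjacency_matrix :: "('n::finite, 'b) pre_digraph \<Rightarrow> real ^ 'n ^ 'n" where
  "adjacency_matrix G = (\<chi> i j. if (i, j) \<in> arcs_ends G then 1 else 0)"

definition eigenvector :: "real ^ 'n ^ 'n \<Rightarrow> real \<Rightarrow> real ^ 'n \<Rightarrow> bool" where
  "eigenvector A c v \<longleftrightarrow> v \<noteq> 0 \<and> A *v v = c *\<^sub>R v"

definition eigenvalues :: "real ^ 'n ^ 'n \<Rightarrow> real set" where
  "eigenvalues A = {c. \<exists>v. eigenvector A c v}"

definition largest_eigenvalue :: "('n::finite, 'b) pre_digraph \<Rightarrow> real" where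
  "largest_eigenvalue G = Max (eigenvalues (adjacency_matrix G))"

definition smallest_eigenvalue :: "('n::finite, 'b) pre_digraph \<Rightarrow> real" where
  "smallest_eigenvalue G = Min (eigenvalues (adjacency_matrix G))"

text \<open>The maximum and minimum are taken over a finite set:\<close>

lemma finite_eigenvalues:
  fixes A :: "real ^ 'n::finite ^ 'n"
  assumes sym: "transpose A = A"
  shows "finite (eigenvalues A)"
proof -
  define f where "f c = (SOME v. eigenvector A c v)" for c
  have f: "f c \<noteq> 0" "A *v f c = c *\<^sub>R f c" if "c \<in> eigenvalues A" for c
    using that someI_ex[of "eigenvector A c"] by (auto simp: f_def eigenvalues_def eigenvector_def)
  have orth: "f c \<bullet> f d = 0" if "c \<in> eigenvalues A" "d \<in> eigenvalues A" "c \<noteq> d" for c d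
  proof -
    have "(A *v f c) \<bullet> f d = f c \<bullet> (A *v f d)"
      by (metis dot_lmul_matrix sym transpose_matrix_vector)
    then have "c * (f c \<bullet> f d) = d * (f c \<bullet> f d)"
      using f that by simp
    then show ?thesis using \<open>c \<noteq> d\<close> by simp
  qed
  have inj: "inj_on f (eigenvalues A)"
    by (rule inj_onI) (metis f(1) inner_eq_zero_iff orth)
  have "independent (f ` eigenvalues A)"
  proof (rule pairwise_orthogonal_independent)
    show "pairwise orthogonal (f ` eigenvalues A)"
      by (auto simp: pairwise_def orthogonal_def) (metis orth)
    show "0 \<notin> f ` eigenvalues A" using f(1) by force
  qed
  then have "finite (f ` eigenvalues A)" by (rule independent_imp_finite)
  with inj show ?thesis by (simp add: finite_image_iff)
qed

lemma transpose_adjacency_matrix: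
  "symmetric G \<Longrightarrow> transpose (adjacency_matrix G) = adjacency_matrix G"
  by (auto simp: adjacency_matrix_def transpose_def vec_eq_iff dest: arcs_ends_symmetric)

end

theory Submission
  imports Defs
begin

text \<open>
  Walk counts are powers of the adjacency matrix: $w_{k+1}(u) = (A^k \mathbf{1})_u$. By
  Perron--Frobenius theory the extreme eigenvalues $\mu$ and $-\mu$ are simple and every other
  eigenvalue is smaller in modulus, so with $a = \sum x_i$ and $b = \sum y_i$ the vectors
  $\mu^{-k} A^k \mathbf{1}$ approach $a\mathbf{x} + (-1)^k b\mathbf{y}$. The limits are therefore
  $(a\mathbf{x} + b\mathbf{y})/(a^2+b^2)$ and $(a\mathbf{x} - b\mathbf{y})/(a^2-b^2)$, and both
  bounds follow from $|y_i| = |x_i|$, $a x_i = |a|\,|x_i|$ and $|b| < |a|$.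
\<close>

section \<open>Self-adjoint operators on an invariant subspace\<close>

text \<open>First-order condition at a maximum: for small \<open>t\<close> with the sign of
  \<open>a\<close> the linear term would dominate and be positive.\<close>

lemma quadratic_le_imp_linear_zero:
  fixes a b :: real
  assumes "\<And>t. 2 * t * a + t\<^sup>2 * b \<le> 0"
  shows "a = 0"
proof (rule ccontr)
  assume "a \<noteq> 0"
  \<comment> \<open>This \<open>t\<close> has the sign of \<open>a\<close> and is so small that
    \<open>t * b\<close> cannot reverse the sign of \<open>2 * a\<close>.\<close>
  define t where "t = a / (\<bar>b\<bar> + 1)"
  have "t * (2 * a + t * b) \<le> 0"
    using assms[of t] by (simp add: algebra_simps power2_eq_square)
  moreover have "2 * a + t * b = t * (2 * (\<bar>b\<bar> + 1) + b)"
    by (simp add: t_def divide_simps) (simp add: algebra_simps)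
  ultimately have "t\<^sup>2 * (2 * (\<bar>b\<bar> + 1) + b) \<le> 0"
    by (simp add: power2_eq_square mult.assoc)
  moreover have "t\<^sup>2 > 0" using \<open>a \<noteq> 0\<close> by (simp add: t_def)
  moreover have "2 * (\<bar>b\<bar> + 1) + b > 0" by (cases "b \<ge> 0") auto
  ultimately show False
    by (simp add: mult_le_0_iff)
qed

text \<open>A unit vector \<open>v\<close> of \<open>W\<close> maximising \<open>norm (f v)\<close>
  satisfies \<open>f (f v) = \<nu>^2 v\<close>, and factoring \<open>f^2 - \<nu>^2\<close> yields an
  eigenvector for \<open>\<nu>\<close> or \<open>-\<nu>\<close>. It is applied to the whole space
  and to the orthogonal complement of the extreme eigenvectors.\<close>

lemma selfadjoint_norm_attained_at_eigenvector:
  fixes f :: "'a::euclidean_space \<Rightarrow> 'a"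
  assumes f: "linear f" and sa: "\<And>u v. f u \<bullet> v = u \<bullet> f v"
    and W: "subspace W" "\<And>v. v \<in> W \<Longrightarrow> f v \<in> W" "W \<noteq> {0}"
  obtains c v where "v \<in> W" "v \<noteq> 0" "f v = c *\<^sub>R v" "\<And>w. w \<in> W \<Longrightarrow> norm (f w) \<le> \<bar>c\<bar> * norm w"
proof -
  interpret linear f by (rule f)
  obtain w where w: "w \<in> W" "w \<noteq> 0"
    using W(1,3) subspace_0 by blast
  have "compact (sphere 0 1 \<inter> W)"
    using closed_subspace[OF W(1)] by (intro compact_Int_closed) auto
  moreover have "w /\<^sub>R norm w \<in> sphere 0 1 \<inter> W"
    using w W(1) by (simp add: subspace_scale)
  moreover have "continuous_on (sphere 0 1 \<inter> W) (\<lambda>v. norm (f v))"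
    using f by (intro continuous_intros linear_continuous_on) (simp add: linear_conv_bounded_linear)
  ultimately obtain v where v: "v \<in> W" "norm v = 1"
      and max: "\<And>u. u \<in> W \<Longrightarrow> norm u = 1 \<Longrightarrow> norm (f u) \<le> norm (f v)"
    using continuous_attains_sup[of "sphere 0 1 \<inter> W" "\<lambda>v. norm (f v)"]
    by (smt (verit, best) Int_iff empty_iff mem_sphere_0)
  define \<nu> where "\<nu> = norm (f v)"
  have bound: "norm (f u) \<le> \<nu> * norm u" if "u \<in> W" for u
  proof (cases "u = 0")
    case False
    have "norm (f (u /\<^sub>R norm u)) \<le> \<nu>"
      using max[of "u /\<^sub>R norm u"] that W(1) False by (simp add: subspace_scale \<nu>_def)
    then show ?thesis using False by (simp add: scale divide_simps mult.commute)
  qed (simp add: zero)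
  \<comment> \<open>Perturbing the maximiser \<open>v\<close> in the direction \<open>z\<close> forces \<open>z = 0\<close>.\<close>
  define z where "z = f (f v) - \<nu>\<^sup>2 *\<^sub>R v"
  have "z \<in> W"
    using v W by (simp add: z_def subspace_diff subspace_scale)
  have "2 * t * (z \<bullet> z) + t\<^sup>2 * (f z \<bullet> f z - \<nu>\<^sup>2 * (z \<bullet> z)) \<le> 0" for t
  proof -
    have "v + t *\<^sub>R z \<in> W" using v \<open>z \<in> W\<close> W(1) by (simp add: subspace_add subspace_scale)
    then have "(norm (f (v + t *\<^sub>R z)))\<^sup>2 \<le> (\<nu> * norm (v + t *\<^sub>R z))\<^sup>2"
      by (intro power_mono bound) auto
    then have "f (v + t *\<^sub>R z) \<bullet> f (v + t *\<^sub>R z) \<le> \<nu>\<^sup>2 * ((v + t *\<^sub>R z) \<bullet> (v + t *\<^sub>R z))"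
      by (simp add: power_mult_distrib power2_norm_eq_inner)
    moreover have "v \<bullet> v = 1" "f v \<bullet> f v = \<nu>\<^sup>2"
      using v by (simp_all add: \<nu>_def power2_norm_eq_inner flip: norm_eq_1)
    then have "f (v + t *\<^sub>R z) \<bullet> f (v + t *\<^sub>R z) = \<nu>\<^sup>2 + 2 * t * (f v \<bullet> f z) + t\<^sup>2 * (f z \<bullet> f z)"
      "(v + t *\<^sub>R z) \<bullet> (v + t *\<^sub>R z) = 1 + 2 * t * (v \<bullet> z) + t\<^sup>2 * (z \<bullet> z)"
      by (simp_all add: add scale inner_simps inner_commute[of z v] inner_commute[of "f z" "f v"]
          power2_eq_square algebra_simps)
    ultimately have "\<nu>\<^sup>2 + 2 * t * (f v \<bullet> f z) + t\<^sup>2 * (f z \<bullet> f z)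
        \<le> \<nu>\<^sup>2 * (1 + 2 * t * (v \<bullet> z) + t\<^sup>2 * (z \<bullet> z))"
      by (simp only:)
    \<comment> \<open>Self-adjointness turns \<open>f (f v) \<bullet> z\<close> into
      \<open>f v \<bullet> f z\<close>, so the linear coefficient of the expansion is exactly
      \<open>z \<bullet> z\<close>.\<close>
    moreover have "z \<bullet> z = f v \<bullet> f z - \<nu>\<^sup>2 * (v \<bullet> z)"
      by (subst (1) z_def) (simp add: sa inner_diff_left)
    then have "2 * t * (z \<bullet> z) = 2 * t * (f v \<bullet> f z) - \<nu>\<^sup>2 * (2 * t * (v \<bullet> z))"
      by (simp only:) (simp add: algebra_simps)
    ultimately show ?thesis by (simp add: distrib_left right_diff_distrib mult.left_commute)
  qed
  then have "z \<bullet> z = 0" by (rule quadratic_le_imp_linear_zero)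
  then have ffv: "f (f v) = \<nu> *\<^sub>R \<nu> *\<^sub>R v" by (simp add: z_def power2_eq_square)
  have "\<nu> \<ge> 0" by (simp add: \<nu>_def)
  \<comment> \<open>The vector \<open>f v + \<nu> v\<close> is annihilated by
    \<open>f - \<nu>\<close>. Either it vanishes and \<open>v\<close> belongs to
    \<open>-\<nu>\<close>, or it is itself an eigenvector for \<open>\<nu>\<close>.\<close>
  show ?thesis
  proof (cases "f v = - \<nu> *\<^sub>R v")
    case True
    then show ?thesis using that[of v "-\<nu>"] v bound \<open>\<nu> \<ge> 0\<close> by fastforce
  next
    case False
    let ?u = "f v + \<nu> *\<^sub>R v"
    have "?u \<in> W" using v W by (simp add: subspace_add subspace_scale)
    moreover have "?u \<noteq> 0" using False by (simp add: add_eq_0_iff2)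
    moreover have "f ?u = \<nu> *\<^sub>R ?u" by (simp add: add scale ffv algebra_simps)
    ultimately show ?thesis using that[of ?u \<nu>] bound \<open>\<nu> \<ge> 0\<close> by simp
  qed
qed

lemma symmetric_matrix_inner:
  fixes A :: "real ^ 'n::finite ^ 'n"
  assumes "transpose A = A"
  shows "(A *v u) \<bullet> v = u \<bullet> (A *v v)"
  by (metis assms dot_lmul_matrix transpose_matrix_vector)

section \<open>Simplicity of the Perron eigenvalue\<close>

text \<open>The transitive closure is not reflexive: the case \<open>i = j\<close> says that each
  index lies on a closed walk of positive length, so no row of \<open>A\<close> is zero.\<close>

locale irreducible_matrix =
  fixes A :: "real ^ 'n::finite ^ 'n"
  assumes sym: "transpose A = A"
    and nonneg: "0 \<le> A $ i $ j"
    and irreducible: "(i, j) \<in> {(i, j). A $ i $ j \<noteq> 0}\<^sup>+"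
begin

lemma exists_neighbour: "\<exists>j. A $ i $ j \<noteq> 0"
  using tranclD[OF irreducible[of i i]] by auto

lemma entry_le: "0 \<le> v \<Longrightarrow> A $ i $ j * v $ j \<le> (A *v v) $ i"
  by (auto simp: matrix_vector_mult_def less_eq_vec_def nonneg intro!: member_le_sum)

text \<open>A zero coordinate spreads: if \<open>v $ j = 0\<close>, the nonnegative terms of
  \<open>(A *v v) $ j = 0\<close> all vanish, so \<open>v\<close> is zero at every neighbour of
  \<open>j\<close> and, by irreducibility, everywhere.\<close>

lemma nonneg_eigenvector_pos:
  assumes "eigenvector A c v" "0 \<le> v"
  shows "0 < v $ i"
proof (rule ccontr)
  assume i: "\<not> 0 < v $ i"
  have Av: "(A *v v) $ k = c * v $ k" for k
    using assms by (simp add: eigenvector_def)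
  have nn: "0 \<le> v $ k" for k using assms(2) by (simp add: less_eq_vec_def)
  have adj: "v $ k = 0" if "v $ j = 0" "A $ j $ k \<noteq> 0" for j k
  proof -
    have "A $ j $ k * v $ k \<le> 0" using entry_le[OF assms(2), of j k] that by (simp add: Av)
    moreover have "A $ j $ k > 0" using that nonneg[of j k] by simp
    ultimately show ?thesis using nn[of k] by (simp add: mult_le_0_iff)
  qed
  have "v $ j = 0" for j
    using irreducible[of i j]
  proof (induction rule: trancl_induct)
    case (base k) then show ?case using i nn[of i] adj[of i k] by auto
  next
    case (step j k) then show ?case using adj[of j k] by auto
  qed
  then have "v = 0" by (simp add: vec_eq_iff)
  then show False using assms(1) by (simp add: eigenvector_def)
qed

end

text \<open>Here \<open>\<mu>\<close> bounds the operator norm; an eigenvector for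
  \<open>\<mu>\<close>, which the lemmas below assume, makes it equal to the norm.\<close>

locale perron_matrix = irreducible_matrix A for A :: "real ^ 'n::finite ^ 'n" +
  fixes \<mu> :: real
  assumes bound: "norm (A *v v) \<le> \<mu> * norm v"
begin

text \<open>\<open>\<bar>v\<bar>\<close> attains the maximum \<open>\<mu>\<close> of the Rayleigh quotient because \<open>v\<close> does.\<close>

lemma abs_eigenvector:
  assumes v: "eigenvector A \<mu> v"
  shows "eigenvector A \<mu> (\<chi> i. \<bar>v $ i\<bar>)"
proof -
  define u :: "real ^ 'n" where "u = (\<chi> i. \<bar>v $ i\<bar>)"
  have uv: "norm u = norm v" by (simp add: u_def norm_vec_def L2_set_def)
  have "\<mu> * (v \<bullet> v) = (A *v v) \<bullet> v" using v by (simp add: eigenvector_def)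
  also have "\<dots> \<le> (A *v u) \<bullet> u"
    unfolding inner_vec_def matrix_vector_mult_def u_def
    by (auto intro!: sum_mono simp: sum_distrib_right) 
       (metis abs_ge_self abs_mult abs_of_nonneg nonneg)
  finally have "\<mu> * (u \<bullet> u) \<le> (A *v u) \<bullet> u" using uv by (simp add: norm_eq)
  moreover have "(A *v u) \<bullet> (A *v u) \<le> \<mu>\<^sup>2 * (u \<bullet> u)"
    using power_mono[OF bound[of u], of 2] by (simp add: power2_norm_eq_inner power_mult_distrib)
  moreover have "\<mu> \<ge> 0"
    using bound[of v] v norm_ge_zero[of "A *v v"] zero_le_mult_iff[of \<mu> "norm v"]
    by (auto simp: eigenvector_def)
  \<comment> \<open>The left side expands to \<open>Au \<bullet> Au - 2 \<mu> (Au \<bullet> u) +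
    \<mu>^2 (u \<bullet> u)\<close>, and the three facts bound it by
    \<open>(1 - 2 + 1) \<mu>^2 (u \<bullet> u)\<close>.\<close>
  ultimately have "(A *v u - \<mu> *\<^sub>R u) \<bullet> (A *v u - \<mu> *\<^sub>R u) \<le> 0"
    using mult_left_mono[of "\<mu> * (u \<bullet> u)" "(A *v u) \<bullet> u" \<mu>]
    by (simp add: inner_simps algebra_simps power2_eq_square inner_commute)
  then have "A *v u = \<mu> *\<^sub>R u"
    by (metis antisym eq_iff_diff_eq_0 inner_eq_zero_iff inner_ge_zero)
  then show ?thesis using uv v by (auto simp: eigenvector_def u_def)
qed

lemma eigenvector_nonzero: "eigenvector A \<mu> v \<Longrightarrow> v $ i \<noteq> 0"
  using nonneg_eigenvector_pos[OF abs_eigenvector, of v i] by (auto simp: less_eq_vec_def)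

lemma eigenvalue_pos:
  assumes v: "eigenvector A \<mu> v"
  shows "\<mu> > 0"
proof -
  define u :: "real ^ 'n" where "u = (\<chi> i. \<bar>v $ i\<bar>)"
  have u: "eigenvector A \<mu> u" "0 \<le> u" using abs_eigenvector[OF v] by (auto simp: u_def less_eq_vec_def)
  fix i
  obtain j where "A $ i $ j \<noteq> 0" using exists_neighbour by blast
  then have "0 < A $ i $ j * u $ j"
    using nonneg[of i j] nonneg_eigenvector_pos[OF u] by simp
  also have "\<dots> \<le> \<mu> * u $ i"
    using entry_le[OF u(2), of i j] u(1) by (simp add: eigenvector_def)
  finally show ?thesis using nonneg_eigenvector_pos[OF u, of i] by (simp add: zero_less_mult_iff)
qed

lemma eigenvector_unique:
  assumes "eigenvector A \<mu> v" "eigenvector A \<mu> w"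
  obtains c where "w = c *\<^sub>R v"
proof -
  fix i
  \<comment> \<open>\<open>w - c v\<close> vanishes at \<open>i\<close>, which an eigenvector for \<open>\<mu>\<close> never does.\<close>
  define c where "c = w $ i / v $ i"
  have "(w - c *\<^sub>R v) $ i = 0" using eigenvector_nonzero[OF assms(1), of i] by (simp add: c_def)
  moreover have "A *v (w - c *\<^sub>R v) = \<mu> *\<^sub>R (w - c *\<^sub>R v)"
    using assms
    by (simp add: eigenvector_def matrix_vector_mult_diff_distrib matrix_vector_mult_scaleR algebra_simps)
  ultimately have "w - c *\<^sub>R v = 0" using eigenvector_nonzero[of "w - c *\<^sub>R v" i] by (auto simp: eigenvector_def)
  then show thesis using that[of c] by simp
qed

text \<open>By simplicity \<open>v\<close> is a multiple of its coordinatewise absolute value, so it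
  has constant sign \<open>c\<close>.\<close>

lemma eigenvector_eq_abs:
  assumes v: "eigenvector A \<mu> v"
  obtains c where "\<bar>c\<bar> = 1" "\<And>i. v $ i = c * \<bar>v $ i\<bar>"
proof -
  obtain c where c: "v = c *\<^sub>R (\<chi> i. \<bar>v $ i\<bar>)"
    using eigenvector_unique[OF abs_eigenvector[OF v] v] by blast
  have vi: "v $ i = c * \<bar>v $ i\<bar>" for i by (subst c) simp
  fix i
  have "\<bar>v $ i\<bar> = \<bar>c\<bar> * \<bar>v $ i\<bar>" using arg_cong[OF vi[of i], of abs] by (simp add: abs_mult)
  then have "\<bar>c\<bar> = 1" using eigenvector_nonzero[OF v, of i] by simp
  then show thesis using that vi by blast
qed

lemma abs_sum_eigenvector:
  assumes v: "eigenvector A \<mu> v"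
  shows "\<bar>\<Sum>i\<in>UNIV. v $ i\<bar> = (\<Sum>i\<in>UNIV. \<bar>v $ i\<bar>)"
proof -
  obtain c where c: "\<bar>c\<bar> = 1" "\<And>i. v $ i = c * \<bar>v $ i\<bar>" using eigenvector_eq_abs[OF v] by blast
  have "(\<Sum>i\<in>UNIV. v $ i) = c * (\<Sum>i\<in>UNIV. \<bar>v $ i\<bar>)"
    unfolding sum_distrib_left by (intro sum.cong refl c(2))
  then show ?thesis by (simp add: abs_mult c(1) sum_nonneg)
qed

text \<open>The common sign of the coordinates occurs twice in the product and cancels. This avoids
  choosing a positive Perron vector.\<close>

lemma sum_mult_eigenvector:
  assumes v: "eigenvector A \<mu> v"
  shows "(\<Sum>j\<in>UNIV. v $ j) * v $ i = \<bar>\<Sum>j\<in>UNIV. v $ j\<bar> * \<bar>v $ i\<bar>"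
proof -
  obtain c where c: "\<bar>c\<bar> = 1" "\<And>i. v $ i = c * \<bar>v $ i\<bar>" using eigenvector_eq_abs[OF v] by blast
  have "(\<Sum>j\<in>UNIV. v $ j) = c * (\<Sum>j\<in>UNIV. \<bar>v $ j\<bar>)"
    unfolding sum_distrib_left by (intro sum.cong refl c(2))
  moreover have "c * c = 1" using c(1) by (metis abs_mult_self_eq mult_1)
  ultimately show ?thesis
    unfolding abs_sum_eigenvector[OF v] using c(2)[of i]
    by (metis mult.assoc mult.left_commute mult_1)
qed

end

section \<open>Bipartite matrices\<close>

text \<open>The two colour classes are encoded by a function \<open>s\<close> with values 1 and
  -1.\<close>

locale bipartite_matrix =
  fixes A :: "real ^ 'n::finite ^ 'n" and s :: "'n \<Rightarrow> real"
  assumes sign: "\<bar>s i\<bar> = 1"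
    and alternating: "A $ i $ j \<noteq> 0 \<Longrightarrow> s j = - s i"
begin

definition flip :: "real ^ 'n \<Rightarrow> real ^ 'n" where
  "flip v = (\<chi> i. s i * v $ i)"

lemma sign_square: "s i * s i = 1"
  using sign[of i] by (auto simp: abs_if split: if_splits)

lemma flip_flip [simp]: "flip (flip v) = v"
  by (simp add: flip_def vec_eq_iff sign_square flip: mult.assoc)

lemma flip_zero_iff [simp]: "flip v = 0 \<longleftrightarrow> v = 0"
proof -
  have "s i \<noteq> 0" for i using sign[of i] by auto
  then show ?thesis by (simp add: flip_def vec_eq_iff)
qed

lemma flip_scaleR: "flip (c *\<^sub>R v) = c *\<^sub>R flip v"
  by (simp add: flip_def vec_eq_iff)

lemma norm_flip [simp]: "norm (flip v) = norm v"
  by (simp add: flip_def norm_vec_def L2_set_def abs_mult sign power_mult_distrib)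

text \<open>Nonzero entries join opposite signs, so the diagonal matrix of \<open>s\<close>
  anticommutes with \<open>A\<close>. Hence \<open>flip\<close> exchanges the eigenspaces of
  \<open>c\<close> and \<open>-c\<close>.\<close>

lemma mult_flip: "A *v flip v = - flip (A *v v)"
proof -
  have "A $ i $ j * (s j * v $ j) = - (s i * (A $ i $ j * v $ j))" for i j
    using alternating[of i j] by (cases "A $ i $ j = 0") auto
  then show ?thesis
    by (simp add: vec_eq_iff matrix_vector_mult_def flip_def sum_negf flip: sum_distrib_left)
qed

lemma eigenvector_flip: "eigenvector A c v \<Longrightarrow> eigenvector A (- c) (flip v)"
  by (simp add: eigenvector_def mult_flip flip_scaleR)

end

section \<open>Asymptotics of the powers of a bipartite Perron matrix\<close>

locale bipartite_perron_matrix = perron_matrix A \<mu> + bipartite_matrix A s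
  for A :: "real ^ 'n::finite ^ 'n" and \<mu> s +
  fixes x y :: "real ^ 'n"
  assumes x: "eigenvector A \<mu> x" "norm x = 1"
    and y: "eigenvector A (- \<mu>) y" "norm y = 1"
begin

lemma flip_y: "eigenvector A \<mu> (flip y)"
  using eigenvector_flip[OF y(1)] by simp

lemma mu_pos: "\<mu> > 0"
  using x(1) by (rule eigenvalue_pos)

lemma orthogonal: "x \<bullet> y = 0"
proof -
  have "\<mu> * (x \<bullet> y) = - \<mu> * (x \<bullet> y)"
    using symmetric_matrix_inner[OF sym, of x y] x y by (simp add: eigenvector_def)
  then show ?thesis using mu_pos by simp
qed

text \<open>By simplicity \<open>flip y\<close> is a multiple of \<open>x\<close>; both have norm 1,
  and \<open>flip\<close> changes only signs.\<close>

lemma abs_y: "\<bar>y $ i\<bar> = \<bar>x $ i\<bar>"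
proof -
  obtain c where c: "flip y = c *\<^sub>R x" using eigenvector_unique[OF x(1) flip_y] by blast
  then have "\<bar>c\<bar> = 1" using x(2) y(2) by (metis norm_flip norm_scaleR mult_1_right)
  moreover have "\<bar>y $ i\<bar> = \<bar>flip y $ i\<bar>" by (simp add: flip_def abs_mult sign)
  ultimately show ?thesis by (simp add: c abs_mult)
qed

text \<open>Both vectors have the same sum of absolute values, attained by \<open>x\<close>. If
  \<open>y\<close> attained it too, \<open>y\<close> would have constant sign, which the negative
  eigenvalue \<open>-\<mu>\<close> of a nonnegative matrix excludes.\<close>

lemma abs_sum_less: "\<bar>\<Sum>i\<in>UNIV. y $ i\<bar> < \<bar>\<Sum>i\<in>UNIV. x $ i\<bar>"
proof (rule ccontr)
  assume "\<not> ?thesis"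
  then have le: "(\<Sum>i\<in>UNIV. \<bar>y $ i\<bar>) \<le> \<bar>\<Sum>i\<in>UNIV. y $ i\<bar>"
    by (simp add: abs_sum_eigenvector[OF x(1)] abs_y)
  \<comment> \<open>\<open>t\<close> is the sign of the coordinate sum of \<open>y\<close>;
    \<open>t *\<^sub>R y\<close> turns out to be nonnegative.\<close>
  obtain t :: real where t: "\<bar>t\<bar> = 1" "\<bar>\<Sum>i\<in>UNIV. y $ i\<bar> = t * (\<Sum>i\<in>UNIV. y $ i)"
    by (metis abs_if abs_minus_cancel abs_one mult_1 mult_minus1)
  have nn: "0 \<le> \<bar>y $ i\<bar> - t * y $ i" for i
    using abs_ge_self[of "t * y $ i"] t(1) by (simp add: abs_mult)
  moreover have "(\<Sum>i\<in>UNIV. \<bar>y $ i\<bar> - t * y $ i) \<le> 0"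
    using le t(2) by (simp add: sum_subtractf flip: sum_distrib_left)
  ultimately have "(\<Sum>i\<in>UNIV. \<bar>y $ i\<bar> - t * y $ i) = 0"
    by (intro antisym sum_nonneg) auto
  then have abs_y_eq: "\<bar>y $ i\<bar> = t * y $ i" for i
    using nn by (simp add: sum_nonneg_eq_0_iff)
  have "0 \<le> t *\<^sub>R y"
    by (simp add: less_eq_vec_def flip: abs_y_eq)
  fix i
  have "0 \<le> (A *v (t *\<^sub>R y)) $ i"
    using entry_le[OF \<open>0 \<le> t *\<^sub>R y\<close>, of i i] nonneg[of i i]
    by (smt (verit) abs_ge_zero abs_y_eq mult_nonneg_nonneg real_scaleR_def vector_scaleR_component)
  also have "\<dots> = - \<mu> * \<bar>y $ i\<bar>"
    using y(1) by (simp add: matrix_vector_mult_scaleR eigenvector_def abs_y_eq)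
  finally show False
    using mu_pos eigenvector_nonzero[OF x(1), of i] abs_y[of i] by (simp add: mult_le_0_iff)
qed

text \<open>On the invariant orthogonal complement of \<open>x\<close> and \<open>y\<close> the norm
  is attained at an eigenvector, whose eigenvalue is neither \<open>\<mu>\<close> nor
  \<open>-\<mu>\<close> because these are simple.\<close>

lemma contraction:
  obtains d where "0 \<le> d" "d < \<mu>"
    "\<And>w. w \<bullet> x = 0 \<Longrightarrow> w \<bullet> y = 0 \<Longrightarrow> norm (A *v w) \<le> d * norm w"
proof -
  define W where "W = {w. w \<bullet> x = 0 \<and> w \<bullet> y = 0}"
  have W: "subspace W" by (auto simp: W_def subspace_def inner_simps)
  have inv: "A *v w \<in> W" if "w \<in> W" for w
    using that x(1) y(1) by (simp add: W_def symmetric_matrix_inner[OF sym] eigenvector_def)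
  show thesis
  \<comment> \<open>With only two coordinates the complement is trivial and has no eigenvector to
    offer; \<open>d = 0\<close> then works.\<close>
  proof (cases "W = {0}")
    case True
    have "norm (A *v w) \<le> 0 * norm w" if "w \<bullet> x = 0" "w \<bullet> y = 0" for w
    proof -
      have "w = 0" using True that unfolding W_def by blast
      then show ?thesis by simp
    qed
    then show ?thesis using that[of 0] mu_pos by blast
  next
    case False
    obtain c v where v: "v \<in> W" "v \<noteq> 0" "A *v v = c *\<^sub>R v"
      and c: "\<And>w. w \<in> W \<Longrightarrow> norm (A *v w) \<le> \<bar>c\<bar> * norm w"
      by (rule selfadjoint_norm_attained_at_eigenvector[OF matrix_vector_mul_linear
          symmetric_matrix_inner[OF sym] W _ False], erule inv, rule that)
    have ev: "eigenvector A c v" using v by (simp add: eigenvector_def)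
    have "c \<noteq> \<mu>"
    proof
      assume "c = \<mu>"
      then obtain a where "v = a *\<^sub>R x" using eigenvector_unique[OF x(1)] ev by metis
      then show False using v(1,2) x(2) by (auto simp: W_def)
    qed
    moreover have "c \<noteq> - \<mu>"
    proof
      assume "c = - \<mu>"
      then have "eigenvector A \<mu> (flip v)" using eigenvector_flip[OF ev] by simp
      then obtain a where "flip v = a *\<^sub>R flip y" using eigenvector_unique[OF flip_y] by metis
      then have "v = a *\<^sub>R y" by (metis flip_flip flip_scaleR)
      then show False using v(1,2) y(2) by (auto simp: W_def)
    qed
    moreover have "\<bar>c\<bar> \<le> \<mu>" using bound[of v] v(2) by (simp add: v(3))
    ultimately have "\<bar>c\<bar> < \<mu>" by linarith
    then show ?thesis using that[of "\<bar>c\<bar>"] c by (simp add: W_def)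
  qed
qed

text \<open>The image of the projection of \<open>v\<close> onto the span of \<open>x\<close> and
  \<open>y\<close> under \<open>(A / \<mu>)^m\<close>; the sign comes from the eigenvalue
  \<open>-\<mu>\<close>.\<close>

definition leading :: "nat \<Rightarrow> real ^ 'n \<Rightarrow> real ^ 'n" where
  "leading m v = (v \<bullet> x) *\<^sub>R x + ((-1) ^ m * (v \<bullet> y)) *\<^sub>R y"

text \<open>The part of \<open>v\<close> orthogonal to \<open>x\<close> and \<open>y\<close> shrinks
  like \<open>(d / \<mu>)^m\<close>. A difference is stated since \<open>leading m v\<close> itself
  may oscillate with the parity of \<open>m\<close>.\<close>

lemma power_minus_leading_tendsto_0:
  "(\<lambda>m. (1 / \<mu> ^ m) *\<^sub>R ((*v) A ^^ m) v - leading m v) \<longlonglongrightarrow> 0"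
proof -
  obtain d where d: "0 \<le> d" "d < \<mu>"
    "\<And>w. w \<bullet> x = 0 \<Longrightarrow> w \<bullet> y = 0 \<Longrightarrow> norm (A *v w) \<le> d * norm w"
    by (rule contraction) blast
  have Ax: "A *v x = \<mu> *\<^sub>R x" and Ay: "A *v y = - \<mu> *\<^sub>R y"
    using x y by (simp_all add: eigenvector_def)
  define w where "w = v - leading 0 v"
  have xx: "x \<bullet> x = 1" "y \<bullet> y = 1" "y \<bullet> x = 0"
    using x(2) y(2) orthogonal by (simp_all add: norm_eq_1 inner_commute)
  \<comment> \<open>Orthogonality is carried through the induction, as the contraction holds only on
    the complement.\<close>
  have w: "((*v) A ^^ m) w \<bullet> x = 0 \<and> ((*v) A ^^ m) w \<bullet> y = 0
      \<and> norm (((*v) A ^^ m) w) \<le> d ^ m * norm w" for m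
  proof (induction m)
    case 0
    then show ?case using xx orthogonal by (simp add: w_def leading_def inner_simps)
  next
    case (Suc m)
    have "norm (((*v) A ^^ Suc m) w) \<le> d * norm (((*v) A ^^ m) w)"
      using Suc d(3) by simp
    also have "\<dots> \<le> d * (d ^ m * norm w)" using Suc d(1) by (intro mult_left_mono) auto
    finally show ?case
      using Suc by (simp add: symmetric_matrix_inner[OF sym] Ax Ay)
  qed
  have decomp: "((*v) A ^^ m) v = \<mu> ^ m *\<^sub>R leading m v + ((*v) A ^^ m) w" for m
  proof (induction m)
    case 0
    then show ?case by (simp add: w_def)
  next
    case (Suc m)
    have "A *v leading m v = \<mu> *\<^sub>R leading (Suc m) v"
      by (simp add: leading_def matrix_vector_right_distrib matrix_vector_mult_scaleR Ax Ay algebra_simps)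
    then show ?case
      by (simp add: Suc matrix_vector_right_distrib matrix_vector_mult_scaleR)
  qed
  have "norm ((1 / \<mu> ^ m) *\<^sub>R ((*v) A ^^ m) v - leading m v) \<le> norm w * (d / \<mu>) ^ m" for m
    using w[of m] mu_pos
    by (simp add: decomp scaleR_add_right divide_simps mult.commute)
  moreover have "(\<lambda>m. norm w * (d / \<mu>) ^ m) \<longlonglongrightarrow> 0"
    using d mu_pos by (intro tendsto_mult_right_zero LIMSEQ_realpow_zero) auto
  ultimately show ?thesis
    by (rule Lim_null_comparison[OF always_eventually[OF allI]])
qed

lemma even_power_tendsto:
  "(\<lambda>k. (1 / \<mu> ^ (2 * k)) *\<^sub>R ((*v) A ^^ (2 * k)) v) \<longlonglongrightarrow> (v \<bullet> x) *\<^sub>R x + (v \<bullet> y) *\<^sub>R y"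
proof -
  have "strict_mono (\<lambda>k::nat. 2 * k)" by (simp add: strict_mono_def)
  from LIMSEQ_subseq_LIMSEQ[OF power_minus_leading_tendsto_0[of v] this]
  show ?thesis by (simp add: o_def leading_def LIM_zero_iff)
qed

lemma odd_power_tendsto:
  "(\<lambda>k. (1 / \<mu> ^ (2 * k + 1)) *\<^sub>R ((*v) A ^^ (2 * k + 1)) v) \<longlonglongrightarrow> (v \<bullet> x) *\<^sub>R x - (v \<bullet> y) *\<^sub>R y"
proof -
  have "strict_mono (\<lambda>k::nat. 2 * k + 1)" by (simp add: strict_mono_def)
  from LIMSEQ_subseq_LIMSEQ[OF power_minus_leading_tendsto_0[of v] this]
  have "(\<lambda>k. (1 / \<mu> ^ (2 * k + 1)) *\<^sub>R ((*v) A ^^ (2 * k + 1)) v - ((v \<bullet> x) *\<^sub>R x - (v \<bullet> y) *\<^sub>R y)) \<longlonglongrightarrow> 0"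
    unfolding o_def leading_def by simp
  then show ?thesis by (rule LIM_zero_cancel)
qed

end

text \<open>Dividing by the coordinate sum \<open>1 \<bullet> X k\<close> cancels any nonzero
  scaling, so the limit can be computed after rescaling by \<open>c k\<close>.\<close>

lemma normalised_tendsto:
  fixes X :: "nat \<Rightarrow> real ^ 'n::finite" and L :: "real ^ 'n"
  assumes lim: "(\<lambda>k. (1 / c k) *\<^sub>R X k) \<longlonglongrightarrow> L" and c: "\<And>k. c k \<noteq> 0" and L: "1 \<bullet> L \<noteq> 0"
  shows "(\<lambda>k. (1 / (1 \<bullet> X k)) *\<^sub>R X k) \<longlonglongrightarrow> (1 / (1 \<bullet> L)) *\<^sub>R L"
proof -
  have "(\<lambda>k. (1 / (1 \<bullet> ((1 / c k) *\<^sub>R X k))) *\<^sub>R ((1 / c k) *\<^sub>R X k)) \<longlonglongrightarrow> (1 / (1 \<bullet> L)) *\<^sub>R L"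
    by (intro tendsto_intros lim L)
  then show ?thesis using c by simp
qed

text \<open>The operator norm is attained at some eigenvalue \<open>c\<close>, and
  \<open>flip\<close> supplies \<open>-c\<close>; every other eigenvalue is bounded by the
  norm.\<close>

lemma bipartite_extreme_eigenvalues:
  fixes A :: "real ^ 'n::finite ^ 'n"
  assumes sym: "transpose A = A" and bip: "bipartite_matrix A s"
  obtains \<mu> where "\<And>v. norm (A *v v) \<le> \<mu> * norm v"
    "Max (eigenvalues A) = \<mu>" "Min (eigenvalues A) = - \<mu>"
proof -
  interpret bipartite_matrix A s by (rule bip)
  have "(1 :: real ^ 'n) \<noteq> 0" by (simp add: vec_eq_iff)
  then have ne: "(UNIV :: (real ^ 'n) set) \<noteq> {0}" by blast
  obtain c v where v: "v \<noteq> 0" "A *v v = c *\<^sub>R v"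
    and bound: "\<And>w. norm (A *v w) \<le> \<bar>c\<bar> * norm w"
    by (rule selfadjoint_norm_attained_at_eigenvector[OF matrix_vector_mul_linear[of A]
        symmetric_matrix_inner[OF sym] subspace_UNIV _ ne], simp, rule that, auto)
  have "eigenvector A c v" using v by (simp add: eigenvector_def)
  then have "c \<in> eigenvalues A" "- c \<in> eigenvalues A"
    using eigenvector_flip by (auto simp: eigenvalues_def)
  then have mem: "\<bar>c\<bar> \<in> eigenvalues A" "- \<bar>c\<bar> \<in> eigenvalues A" by (auto simp: abs_if)
  have le: "\<bar>e\<bar> \<le> \<bar>c\<bar>" if e: "e \<in> eigenvalues A" for e
  proof -
    obtain u where "u \<noteq> 0" "A *v u = e *\<^sub>R u"
      using e by (auto simp: eigenvalues_def eigenvector_def)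
    then show ?thesis using bound[of u] by simp
  qed
  have "Max (eigenvalues A) = \<bar>c\<bar>"
    by (rule Max_eqI[OF finite_eigenvalues[OF sym]]) (use mem le in force)+
  moreover have "Min (eigenvalues A) = - \<bar>c\<bar>"
    by (rule Min_eqI[OF finite_eigenvalues[OF sym]]) (use mem le in force)+
  ultimately show thesis using that bound by blast
qed

section \<open>Walks\<close>

text \<open>Symmetry of \<open>G\<close> turns connectedness into directed reachability, which is
  reflexive; a second vertex upgrades it to walks of positive length.\<close>

lemma irreducible_adjacency_matrix:
  fixes G :: "('n::finite, 'b) pre_digraph"
  assumes "Digraph.graph G" and "verts G = UNIV" and "CARD('n) \<ge> 2"
    and "Digraph_Component.connected G"
  shows "irreducible_matrix (adjacency_matrix G)"
proof -
  interpret graph G by fact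
  have edges: "{(i, j). adjacency_matrix G $ i $ j \<noteq> 0} = arcs_ends G"
    by (auto simp: adjacency_matrix_def split: if_splits)
  have reach: "(i, j) \<in> (arcs_ends G)\<^sup>*" for i j
  proof -
    have "i \<rightarrow>\<^sup>*\<^bsub>mk_symmetric G\<^esub> j"
      using assms(2,4) by (auto simp: connected_def strongly_connected_def)
    then have "i \<rightarrow>\<^sup>*\<^bsub>G\<^esub> j" using reachable_mk_symmetric_eq[OF sym_arcs] by simp
    then show ?thesis by (rule reachable_rtranclI)
  qed
  have "(i, j) \<in> (arcs_ends G)\<^sup>+" for i j
  proof -
    \<comment> \<open>A detour through some \<open>k\<close> other than \<open>i\<close> makes the
      walk nonempty even when \<open>i = j\<close>.\<close>
    have "UNIV \<noteq> {i}" using assms(3) by (metis card.empty card_insert_disjoint empty_iff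
          finite.emptyI not_less_eq_eq numeral_2_eq_2 order_refl)
    then obtain k where "k \<noteq> i" by blast
    then have "(i, k) \<in> (arcs_ends G)\<^sup>+" using reach[of i k] by (metis rtranclD)
    then show ?thesis using reach[of k j] by (rule trancl_rtrancl_trancl)
  qed
  then show ?thesis
    using transpose_adjacency_matrix[OF sym_arcs]
    by (simp add: irreducible_matrix_def edges) (simp add: adjacency_matrix_def)
qed

lemma bipartite_adjacency_matrix:
  assumes "bipartite G"
  obtains s where "bipartite_matrix (adjacency_matrix G) s"
proof -
  obtain U V where "U \<inter> V = {}" and arcs: "arcs_ends G \<subseteq> U \<times> V \<union> V \<times> U"
    using assms by (auto simp: bipartite_def)
  then have "bipartite_matrix (adjacency_matrix G) (\<lambda>i. if i \<in> U then 1 else - 1)"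
    by unfold_locales (auto simp: adjacency_matrix_def split: if_splits)
  then show thesis by (rule that)
qed

lemma finite_walks:
  fixes G :: "('n::finite, 'b) pre_digraph"
  shows "finite {p. vwalk p G \<and> length p = k}"
  by (rule finite_subset[OF _ finite_lists_length_eq[of UNIV k]]) auto

lemma num_walks_from_one:
  "u \<in> verts G \<Longrightarrow> num_walks_from G (Suc 0) u = 1"
proof -
  assume "u \<in> verts G"
  then have "{p. vwalk p G \<and> length p = Suc 0 \<and> hd p = u} = {[u]}"
    by (auto simp: length_Suc_conv vwalk_def)
  then show ?thesis by (simp add: num_walks_from_def)
qed

text \<open>Deleting the first vertex leaves a walk from a neighbour. The double \<open>Suc\<close>
  keeps that tail nonempty, as \<open>vwalk\<close> demands.\<close>

lemma num_walks_from_Suc: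
  fixes G :: "('n::finite, 'b) pre_digraph"
  assumes "u \<in> verts G"
  shows "num_walks_from G (Suc (Suc k)) u = (\<Sum>v | (u, v) \<in> arcs_ends G. num_walks_from G (Suc k) v)"
proof -
  let ?W = "\<lambda>v. {p. vwalk p G \<and> length p = Suc k \<and> hd p = v}"
  have "{p. vwalk p G \<and> length p = Suc (Suc k) \<and> hd p = u}
      = (\<Union>v\<in>{v. (u, v) \<in> arcs_ends G}. (#) u ` ?W v)"
    using assms by (auto simp: length_Suc_conv vwalk_def image_iff)
  also have "card \<dots> = (\<Sum>v | (u, v) \<in> arcs_ends G. card ((#) u ` ?W v))"
    by (intro card_UN_disjoint ballI finite_imageI finite_subset[OF _ finite_walks[of G "Suc k"]])
       auto
  finally show ?thesis by (simp add: num_walks_from_def card_image)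
qed

text \<open>A walk on \<open>k + 1\<close> vertices makes \<open>k\<close> steps, so odd walk
  lengths correspond to even powers.\<close>

lemma walk_vector_Suc:
  fixes G :: "('n::finite, 'b) pre_digraph"
  assumes "verts G = UNIV"
  shows "walk_vector G (Suc k) = ((*v) (adjacency_matrix G) ^^ k) 1"
proof (induction k)
  case 0
  then show ?case using assms by (simp add: walk_vector_def num_walks_from_one vec_eq_iff)
next
  case (Suc k)
  have "walk_vector G (Suc (Suc k)) = adjacency_matrix G *v walk_vector G (Suc k)"
    using assms
    by (simp add: walk_vector_def num_walks_from_Suc vec_eq_iff matrix_vector_mult_def
        adjacency_matrix_def if_distrib[of "\<lambda>a. a * _"] sum.If_cases cong: if_cong)
  then show ?case by (simp add: Suc)
qed

lemma num_walks_eq_inner: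
  fixes G :: "('n::finite, 'b) pre_digraph"
  shows "real (num_walks G k) = 1 \<bullet> walk_vector G k"
proof -
  have "{p. vwalk p G \<and> length p = k} = (\<Union>u. {p. vwalk p G \<and> length p = k \<and> hd p = u})"
    by auto
  also have "card \<dots> = (\<Sum>u\<in>UNIV. num_walks_from G k u)"
    unfolding num_walks_from_def
    by (intro card_UN_disjoint ballI finite_subset[OF _ finite_walks[of G k]]) auto
  finally show ?thesis by (simp add: num_walks_def walk_vector_def inner_vec_def)
qed

theorem theorem4:
  fixes G :: "('n::finite, 'b) pre_digraph" and x y :: "real ^ 'n"
  assumes "Digraph.graph G" and "verts G = UNIV" and "CARD('n) \<ge> 2"
    and "Digraph_Component.connected G" and "bipartite G"
    and "eigenvector (adjacency_matrix G) (largest_eigenvalue G) x" and "norm x = 1"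
    and "eigenvector (adjacency_matrix G) (smallest_eigenvalue G) y" and "norm y = 1"
  shows
    "convergent (\<lambda>k. (1 / real (num_walks G (2*k+1))) *\<^sub>R walk_vector G (2*k+1)) \<and>
     lim (\<lambda>k. (1 / real (num_walks G (2*k+1))) *\<^sub>R walk_vector G (2*k+1)) \<ge>
       ((\<bar>\<Sum>i\<in>UNIV. x $ i\<bar> - \<bar>\<Sum>i\<in>UNIV. y $ i\<bar>) /
        (\<bar>\<Sum>i\<in>UNIV. x $ i\<bar>^2 + \<bar>\<Sum>i\<in>UNIV. y $ i\<bar>^2)) *\<^sub>R x \<and>
     convergent (\<lambda>k. (1 / real (num_walks G (2*k))) *\<^sub>R walk_vector G (2*k)) \<and>
     lim (\<lambda>k. (1 / real (num_walks G (2*k))) *\<^sub>R walk_vector G (2*k)) \<ge>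
       (1 / (\<bar>\<Sum>i\<in>UNIV. x $ i\<bar> + \<bar>\<Sum>i\<in>UNIV. y $ i\<bar>)) *\<^sub>R x"
proof -
  let ?A = "adjacency_matrix G"
  interpret irreducible_matrix ?A
    by (rule irreducible_adjacency_matrix[OF assms(1-4)])
  obtain s where bip: "bipartite_matrix ?A s"
    using bipartite_adjacency_matrix[OF assms(5)] by blast
  obtain \<mu> where bound: "\<And>v. norm (?A *v v) \<le> \<mu> * norm v"
    and \<mu>: "largest_eigenvalue G = \<mu>" "smallest_eigenvalue G = - \<mu>"
    unfolding largest_eigenvalue_def smallest_eigenvalue_def
    using bipartite_extreme_eigenvalues[OF sym bip] by blast
  interpret bipartite_matrix ?A s by (rule bip)
  interpret bipartite_perron_matrix ?A \<mu> s x y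
    using bound assms(6-9) by unfold_locales (simp_all add: \<mu>)
  define a where "a = (\<Sum>i\<in>UNIV. x $ i)"
  define b where "b = (\<Sum>i\<in>UNIV. y $ i)"
  have inner: "1 \<bullet> x = a" "1 \<bullet> y = b" by (simp_all add: inner_vec_def a_def b_def)
  have ba: "\<bar>b\<bar> < \<bar>a\<bar>" using abs_sum_less by (simp add: a_def b_def)
  have sq: "b\<^sup>2 < a\<^sup>2" using power_strict_mono[OF ba, of 2] by simp
  have ax: "a * x $ i = \<bar>a\<bar> * \<bar>x $ i\<bar>" for i
    using sum_mult_eigenvector[OF x(1)] by (simp add: a_def)
  have byx: "\<bar>b * y $ i\<bar> = \<bar>b\<bar> * \<bar>x $ i\<bar>" for i by (simp add: abs_mult abs_y)
  \<comment> \<open>Used with \<open>t = b * y $ i\<close> for odd and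
    \<open>t = - (b * y $ i)\<close> for even walk lengths.\<close>
  have lower: "(\<bar>a\<bar> - \<bar>b\<bar>) * x $ i \<le> a * x $ i + t" if "\<bar>t\<bar> = \<bar>b\<bar> * \<bar>x $ i\<bar>" for i t
  proof -
    have "(\<bar>a\<bar> - \<bar>b\<bar>) * x $ i \<le> (\<bar>a\<bar> - \<bar>b\<bar>) * \<bar>x $ i\<bar>"
      using ba by (intro mult_left_mono) auto
    also have "\<dots> \<le> a * x $ i + t" using that by (simp add: ax algebra_simps)
    finally show ?thesis .
  qed
  have ratio: "(1 / real (num_walks G (Suc m))) *\<^sub>R walk_vector G (Suc m)
      = (1 / (1 \<bullet> ((*v) ?A ^^ m) 1)) *\<^sub>R ((*v) ?A ^^ m) 1" for m
    by (simp only: num_walks_eq_inner walk_vector_Suc[OF assms(2)])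
  let ?P = "a *\<^sub>R x + b *\<^sub>R y" and ?M = "a *\<^sub>R x - b *\<^sub>R y"
  have P: "1 \<bullet> ?P = a\<^sup>2 + b\<^sup>2" and M: "1 \<bullet> ?M = a\<^sup>2 - b\<^sup>2"
    by (simp_all add: inner_simps inner power2_eq_square)
  have "(\<lambda>k. (1 / real (num_walks G (2*k+1))) *\<^sub>R walk_vector G (2*k+1)) \<longlonglongrightarrow> (1 / (1 \<bullet> ?P)) *\<^sub>R ?P"
    unfolding Suc_eq_plus1[symmetric] ratio
  proof (rule normalised_tendsto)
    show "(\<lambda>k. (1 / \<mu> ^ (2 * k)) *\<^sub>R ((*v) ?A ^^ (2 * k)) 1) \<longlonglongrightarrow> ?P"
      using even_power_tendsto[of 1] by (simp add: inner)
    show "1 \<bullet> ?P \<noteq> 0" using sq P by (smt (verit) zero_le_power2)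
  qed (use mu_pos in simp)
  moreover have "((\<bar>a\<bar> - \<bar>b\<bar>) / (\<bar>a\<bar>^2 + \<bar>b\<bar>^2)) *\<^sub>R x \<le> (1 / (1 \<bullet> ?P)) *\<^sub>R ?P"
    unfolding less_eq_vec_def P
    using lower[OF byx] by (simp add: divide_right_mono)
  moreover have "(\<lambda>k. (1 / real (num_walks G (2*k))) *\<^sub>R walk_vector G (2*k)) \<longlonglongrightarrow> (1 / (1 \<bullet> ?M)) *\<^sub>R ?M"
  \<comment> \<open>The term at \<open>k = 0\<close> is the default value 0, not a power of the
    matrix applied to \<open>1\<close>, so the sequence is shifted by one.\<close>
  proof (rule LIMSEQ_imp_Suc)
    have eq: "2 * Suc k = Suc (2 * k + 1)" for k by simp
    show "(\<lambda>k. (1 / real (num_walks G (2 * Suc k))) *\<^sub>R walk_vector G (2 * Suc k)) \<longlonglongrightarrow> (1 / (1 \<bullet> ?M)) *\<^sub>R ?M"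
      unfolding eq ratio
    proof (rule normalised_tendsto)
      show "(\<lambda>k. (1 / \<mu> ^ (2 * k + 1)) *\<^sub>R ((*v) ?A ^^ (2 * k + 1)) 1) \<longlonglongrightarrow> ?M"
        using odd_power_tendsto[of 1] unfolding inner .
      show "1 \<bullet> ?M \<noteq> 0" using sq M by simp
    qed (use mu_pos in simp)
  qed
  moreover have "(1 / (\<bar>a\<bar> + \<bar>b\<bar>)) *\<^sub>R x \<le> (1 / (1 \<bullet> ?M)) *\<^sub>R ?M"
    unfolding less_eq_vec_def
  proof
    fix i
    \<comment> \<open>Extending by the positive factor \<open>\<bar>a\<bar> - \<bar>b\<bar>\<close>
      brings the bound to the denominator \<open>a^2 - b^2\<close> of the limit.\<close>
    have "1 / (\<bar>a\<bar> + \<bar>b\<bar>) = (\<bar>a\<bar> - \<bar>b\<bar>) / ((\<bar>a\<bar> + \<bar>b\<bar>) * (\<bar>a\<bar> - \<bar>b\<bar>))" using ba by simp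
    also have "(\<bar>a\<bar> + \<bar>b\<bar>) * (\<bar>a\<bar> - \<bar>b\<bar>) = a\<^sup>2 - b\<^sup>2"
      using power2_abs[of a] power2_abs[of b] by (simp add: power2_eq_square algebra_simps)
    finally have "((1 / (\<bar>a\<bar> + \<bar>b\<bar>)) *\<^sub>R x) $ i = ((\<bar>a\<bar> - \<bar>b\<bar>) * x $ i) / (a\<^sup>2 - b\<^sup>2)"
      by simp
    also have "\<dots> \<le> (a * x $ i - b * y $ i) / (a\<^sup>2 - b\<^sup>2)"
      using lower[of "- (b * y $ i)" i] byx[of i] sq by (intro divide_right_mono) auto
    finally show "((1 / (\<bar>a\<bar> + \<bar>b\<bar>)) *\<^sub>R x) $ i \<le> ((1 / (1 \<bullet> ?M)) *\<^sub>R ?M) $ i"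
      by (simp add: M)
  qed
  ultimately show ?thesis
    unfolding a_def[symmetric] b_def[symmetric]
    by (auto simp: convergent_def limI)
qed

end
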